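(* Let $R$ be a commutative ring with unity such that $\mathrm{Max}\,R$ is Hausdorff and totally disconnected. Then $R$ is local-global.
   Context: $\mathrm{Max}\,R$ is the space of maximal ideals of $R$ with the Zariski topology. $R$ is local-global if each polynomial over $R$ in finitely many indeterminates which admits unit values locally admits unit values; that is, whenever $f\in R[X_1,\dots,X_n]$ is such that for every maximal ideal $P$ there exist $b_1,\dots,b_n\in R_P$ with $f(b_1,\dots,b_n)$ a unit of $R_P$, there exist $r_1,\dots,r_n\in R$ with $f(r_1,\dots,r_n)$ a unit of $R$. *)

theory Defs
  imports "HOL-Algebra.Indexed_Polynomials" "HOL-Analysis.T1_Spaces"
begin

definition Max_ideals :: "('a, 'm) ring_scheme \<Rightarrow> 'a set set"
  where "Max_ideals R = {M. maximalideal M R}"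

text \<open>The closed sets are those of the form \<open>{M. E \<subseteq> M}\<close> for \<open>E \<subseteq> carrier R\<close>.\<close>

definition Max_space :: "('a, 'm) ring_scheme \<Rightarrow> 'a set topology"
  where "Max_space R =
    topology (\<lambda>U. \<exists>E \<subseteq> carrier R. U = Max_ideals R - {M \<in> Max_ideals R. E \<subseteq> M})"

definition totally_disconnected_space :: "'a topology \<Rightarrow> bool"
  where "totally_disconnected_space T \<longleftrightarrow> (\<forall>C. connectedin T C \<longrightarrow> (\<exists>x. C \<subseteq> {x}))"

definition fraction_rel :: "('a, 'm) ring_scheme \<Rightarrow> 'a set \<Rightarrow> (('a \<times> 'a) \<times> ('a \<times> 'a)) set"
  where "fraction_rel R S =
    {((a, s), (b, t)). a \<in> carrier R \<and> s \<in> S \<and> b \<in> carrier R \<and> t \<in> S \<and>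
       (\<exists>u\<in>S. u \<otimes>\<^bsub>R\<^esub> (t \<otimes>\<^bsub>R\<^esub> a \<ominus>\<^bsub>R\<^esub> s \<otimes>\<^bsub>R\<^esub> b) = \<zero>\<^bsub>R\<^esub>)}"

definition fraction :: "('a, 'm) ring_scheme \<Rightarrow> 'a set \<Rightarrow> 'a \<Rightarrow> 'a \<Rightarrow> ('a \<times> 'a) set"
  where "fraction R S a s = fraction_rel R S `` {(a, s)}"

text \<open>The ring of fractions with denominators in a submonoid \<open>S\<close> of \<open>R\<close>. As for \<^const>\<open>FactRing\<close>, the
  operations form a union over all representatives; by lemmas \<open>fraction_mult\<close> and \<open>fraction_add\<close>
  below, it is the union of a single class.\<close>

definition fraction_ring :: "('a, 'm) ring_scheme \<Rightarrow> 'a set \<Rightarrow> ('a \<times> 'a) set ring"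
  where "fraction_ring R S =
    \<lparr>carrier = (carrier R \<times> S) // fraction_rel R S,
     monoid.mult = (\<lambda>A B. \<Union>(a, s)\<in>A. \<Union>(b, t)\<in>B. fraction R S (a \<otimes>\<^bsub>R\<^esub> b) (s \<otimes>\<^bsub>R\<^esub> t)),
     one = fraction R S \<one>\<^bsub>R\<^esub> \<one>\<^bsub>R\<^esub>,
     zero = fraction R S \<zero>\<^bsub>R\<^esub> \<one>\<^bsub>R\<^esub>,
     add = (\<lambda>A B. \<Union>(a, s)\<in>A. \<Union>(b, t)\<in>B.
       fraction R S (t \<otimes>\<^bsub>R\<^esub> a \<oplus>\<^bsub>R\<^esub> s \<otimes>\<^bsub>R\<^esub> b) (s \<otimes>\<^bsub>R\<^esub> t))\<rparr>"

definition local_ring_at :: "('a, 'm) ring_scheme \<Rightarrow> 'a set \<Rightarrow> ('a \<times> 'a) set ring"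
  where "local_ring_at R P = fraction_ring R (carrier R - P)"

definition local_map :: "('a, 'm) ring_scheme \<Rightarrow> 'a set \<Rightarrow> 'a \<Rightarrow> ('a \<times> 'a) set"
  where "local_map R P a = fraction R (carrier R - P) a \<one>\<^bsub>R\<^esub>"

text \<open>The value at \<open>b\<close> in \<open>A\<close> of a polynomial \<open>f\<close> over \<open>R\<close>, with the coefficients carried to \<open>A\<close>
  by \<open>h\<close>. The monomials are multisets of indeterminates.\<close>

definition indexed_value ::
    "('a, 'm) ring_scheme \<Rightarrow> ('b, 'n) ring_scheme \<Rightarrow> ('a \<Rightarrow> 'b) \<Rightarrow> ('c multiset \<Rightarrow> 'a) \<Rightarrow> ('c \<Rightarrow> 'b) \<Rightarrow> 'b"
  where "indexed_value R A h f b =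
    finsum A (\<lambda>m. h (f m) \<otimes>\<^bsub>A\<^esub> finprod A (\<lambda>i. b i [^]\<^bsub>A\<^esub> count m i) (set_mset m))
      {m. f m \<noteq> \<zero>\<^bsub>R\<^esub>}"

definition local_global :: "('a, 'm) ring_scheme \<Rightarrow> bool"
  where "local_global R \<longleftrightarrow>
    (\<forall>n. \<forall>f \<in> ring.indexed_pset R {1..n::nat} (carrier R).
      (\<forall>P. maximalideal P R \<longrightarrow>
        (\<exists>b \<in> {1..n} \<rightarrow> carrier (local_ring_at R P).
          indexed_value R (local_ring_at R P) (local_map R P) f b \<in> Units (local_ring_at R P))) \<longrightarrow>
      (\<exists>r \<in> {1..n} \<rightarrow> carrier R. indexed_value R R (\<lambda>a. a) f r \<in> Units R))"


lemma UN_pairs_const: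
  assumes "(a, s) \<in> A" "(b, t) \<in> B"
    and "\<And>a' s' b' t'. (a', s') \<in> A \<Longrightarrow> (b', t') \<in> B \<Longrightarrow> F a' s' b' t' = c"
  shows "(\<Union>(a, s)\<in>A. \<Union>(b, t)\<in>B. F a s b t) = c"
proof -
  have "(\<Union>(b, t)\<in>B. F a' s' b t) = c" if "(a', s') \<in> A" for a' s'
  proof -
    have "(case y of (b, t) \<Rightarrow> F a' s' b t) = c" if "y \<in> B" for y
      using assms(3) \<open>(a', s') \<in> A\<close> that by (cases y) auto
    with assms(2) have "(\<lambda>(b, t). F a' s' b t) ` B = {c}" by force
    then show ?thesis by simp
  qed
  then have "(case x of (a, s) \<Rightarrow> \<Union>(b, t)\<in>B. F a s b t) = c" if "x \<in> A" for x
    using that by (cases x) auto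
  with assms(1) have "(\<lambda>(a, s). \<Union>(b, t)\<in>B. F a s b t) ` A = {c}" by force
  then show ?thesis by simp
qed

context cring
begin

lemma openin_Max_space:
  "openin (Max_space R) U \<longleftrightarrow> (\<exists>E \<subseteq> carrier R. U = Max_ideals R - {M \<in> Max_ideals R. E \<subseteq> M})"
proof -
  let ?L = "\<lambda>U. \<exists>E \<subseteq> carrier R. U = Max_ideals R - {M \<in> Max_ideals R. E \<subseteq> M}"
  have prime: "a \<in> M \<or> b \<in> M"
    if "M \<in> Max_ideals R" "a \<in> carrier R" "b \<in> carrier R" "a \<otimes> b \<in> M" for M a b
  proof -
    from that(1) have "maximalideal M R" by (simp add: Max_ideals_def)
    from primeideal.I_prime[OF maximalideal_prime[OF this] that(2-4)] show ?thesis .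
  qed
  have idl: "ideal M R" if "M \<in> Max_ideals R" for M
    using that by (simp add: Max_ideals_def maximalideal_def)
  have "istopology ?L"
    unfolding istopology_def
  proof (intro conjI allI impI)
    fix U V assume "?L U" "?L V"
    then obtain E F where E: "E \<subseteq> carrier R" "U = Max_ideals R - {M \<in> Max_ideals R. E \<subseteq> M}"
      and F: "F \<subseteq> carrier R" "V = Max_ideals R - {M \<in> Max_ideals R. F \<subseteq> M}" by auto
    let ?G = "{a \<otimes> b |a b. a \<in> E \<and> b \<in> F}"
    have "?G \<subseteq> M \<longleftrightarrow> E \<subseteq> M \<or> F \<subseteq> M" if M: "M \<in> Max_ideals R" for M
    proof
      assume G: "?G \<subseteq> M"
      show "E \<subseteq> M \<or> F \<subseteq> M"
      proof (rule ccontr)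
        assume "\<not> ?thesis"
        then obtain a b where "a \<in> E" "a \<notin> M" "b \<in> F" "b \<notin> M" by auto
        moreover from this G have "a \<otimes> b \<in> M" by blast
        ultimately show False using prime[OF M, of a b] E(1) F(1) by blast
      qed
    next
      assume "E \<subseteq> M \<or> F \<subseteq> M"
      then show "?G \<subseteq> M"
        using E(1) F(1) ideal.I_l_closed[OF idl[OF M]] ideal.I_r_closed[OF idl[OF M]] by blast
    qed
    note G = this
    have "U \<inter> V = Max_ideals R - {M \<in> Max_ideals R. ?G \<subseteq> M}"
    proof (rule Set.set_eqI)
      fix M
      show "M \<in> U \<inter> V \<longleftrightarrow> M \<in> Max_ideals R - {M \<in> Max_ideals R. ?G \<subseteq> M}"
        unfolding E(2) F(2) Int_iff Diff_iff mem_Collect_eq using G[of M] by argo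
    qed
    moreover have "?G \<subseteq> carrier R" using E F by auto
    ultimately show "?L (U \<inter> V)" by blast
  next
    fix \<K> assume "\<forall>K\<in>\<K>. ?L K"
    then have "\<forall>K\<in>\<K>. \<exists>E. E \<subseteq> carrier R \<and> Max_ideals R - {M \<in> Max_ideals R. E \<subseteq> M} = K"
      by metis
    then obtain E where E: "\<forall>K\<in>\<K>. E K \<subseteq> carrier R \<and>
        Max_ideals R - {M \<in> Max_ideals R. E K \<subseteq> M} = K"
      by (rule bchoice[THEN exE])
    have "\<Union>\<K> = (\<Union>K\<in>\<K>. Max_ideals R - {M \<in> Max_ideals R. E K \<subseteq> M})"
      using E by simp
    then have "\<Union>\<K> = Max_ideals R - {M \<in> Max_ideals R. (\<Union>K\<in>\<K>. E K) \<subseteq> M}"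
      by auto
    moreover have "(\<Union>K\<in>\<K>. E K) \<subseteq> carrier R" using E by blast
    ultimately show "?L (\<Union>\<K>)" by blast
  qed
  then show ?thesis unfolding Max_space_def by simp
qed

lemma topspace_Max_space: "topspace (Max_space R) = Max_ideals R"
proof
  show "topspace (Max_space R) \<subseteq> Max_ideals R"
    using openin_topspace[of "Max_space R"] unfolding openin_Max_space by auto
  have "\<not> carrier R \<subseteq> M" if "M \<in> Max_ideals R" for M
  proof -
    from that have m: "maximalideal M R" by (simp add: Max_ideals_def)
    have "M \<subseteq> carrier R"
      using m by (simp add: maximalideal_def ideal_def additive_subgroup.a_subset)
    with maximalideal.I_notcarr[OF m] show ?thesis by blast
  qed
  then have "Max_ideals R = Max_ideals R - {M \<in> Max_ideals R. carrier R \<subseteq> M}" by auto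
  then have "openin (Max_space R) (Max_ideals R)"
    unfolding openin_Max_space by blast
  then show "Max_ideals R \<subseteq> topspace (Max_space R)" by (rule openin_subset)
qed

context
  fixes S assumes S: "submonoid S R"
begin

lemma S_carr: "s \<in> S \<Longrightarrow> s \<in> carrier R"
  and S_mult: "s \<in> S \<Longrightarrow> t \<in> S \<Longrightarrow> s \<otimes> t \<in> S"
  and S_one: "\<one> \<in> S"
  using submonoid.subset[OF S] submonoid.m_closed[OF S] submonoid.one_closed[OF S] by auto

lemma fraction_rel_iff:
  "((a, s), (b, t)) \<in> fraction_rel R S \<longleftrightarrow> a \<in> carrier R \<and> s \<in> S \<and> b \<in> carrier R \<and> t \<in> S \<and>
     (\<exists>u\<in>S. u \<otimes> (t \<otimes> a) = u \<otimes> (s \<otimes> b))"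
proof -
  have "u \<otimes> (t \<otimes> a \<ominus> s \<otimes> b) = \<zero> \<longleftrightarrow> u \<otimes> (t \<otimes> a) = u \<otimes> (s \<otimes> b)"
    if "a \<in> carrier R" "s \<in> S" "b \<in> carrier R" "t \<in> S" "u \<in> S" for u
  proof -
    note c = that S_carr[of s] S_carr[of t] S_carr[of u]
    have "u \<otimes> (t \<otimes> a \<ominus> s \<otimes> b) = u \<otimes> (t \<otimes> a) \<ominus> u \<otimes> (s \<otimes> b)"
      using c by (simp add: a_minus_def r_distr r_minus)
    then show ?thesis using c by (simp add: r_right_minus_eq)
  qed
  then show ?thesis unfolding fraction_rel_def by auto
qed

lemma equiv_fraction_rel: "equiv (carrier R \<times> S) (fraction_rel R S)"
proof (rule equivI)
  show "fraction_rel R S \<subseteq> (carrier R \<times> S) \<times> (carrier R \<times> S)"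
    unfolding fraction_rel_def by auto
  show "refl_on (carrier R \<times> S) (fraction_rel R S)"
    using S_one by (auto simp: refl_on_def fraction_rel_iff)
  show "sym (fraction_rel R S)"
  proof (rule symI)
    fix x y assume "(x, y) \<in> fraction_rel R S"
    then show "(y, x) \<in> fraction_rel R S"
      by (cases x, cases y) (simp only: fraction_rel_iff, metis)
  qed
  show "trans (fraction_rel R S)"
  proof (rule transI, clarsimp simp: fraction_rel_iff)
    fix a s b t c r u v
    assume a: "a \<in> carrier R" "b \<in> carrier R" "c \<in> carrier R" "s \<in> S" "t \<in> S" "r \<in> S" "u \<in> S" "v \<in> S"
      and 1: "u \<otimes> (t \<otimes> a) = u \<otimes> (s \<otimes> b)" and 2: "v \<otimes> (r \<otimes> b) = v \<otimes> (t \<otimes> c)"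
    note c = a S_carr[OF a(4)] S_carr[OF a(5)] S_carr[OF a(6)] S_carr[OF a(7)] S_carr[OF a(8)]
    have "(u \<otimes> v \<otimes> t) \<otimes> (r \<otimes> a) = (v \<otimes> r) \<otimes> (u \<otimes> (t \<otimes> a))" using c by (simp add: m_ac)
    also have "\<dots> = (u \<otimes> s) \<otimes> (v \<otimes> (r \<otimes> b))" unfolding 1 using c by (simp add: m_ac)
    also have "\<dots> = (u \<otimes> v \<otimes> t) \<otimes> (s \<otimes> c)" unfolding 2 using c by (simp add: m_ac)
    finally show "\<exists>u\<in>S. u \<otimes> (r \<otimes> a) = u \<otimes> (s \<otimes> c)"
      using S_mult a by (intro bexI[of _ "u \<otimes> v \<otimes> t"]) auto
  qed
qed

lemma fraction_eq_iff:
  assumes "a \<in> carrier R" "s \<in> S" "b \<in> carrier R" "t \<in> S"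
  shows "fraction R S a s = fraction R S b t \<longleftrightarrow> (\<exists>u\<in>S. u \<otimes> (t \<otimes> a) = u \<otimes> (s \<otimes> b))"
  unfolding fraction_def using eq_equiv_class_iff[OF equiv_fraction_rel, of "(a,s)" "(b,t)"] assms
  by (simp add: fraction_rel_iff)

lemma carrier_fraction_ring:
  "carrier (fraction_ring R S) = {fraction R S a s |a s. a \<in> carrier R \<and> s \<in> S}"
  unfolding fraction_ring_def fraction_def quotient_def by auto

lemma fraction_mem: "a \<in> carrier R \<Longrightarrow> s \<in> S \<Longrightarrow> (a, s) \<in> fraction R S a s"
  unfolding fraction_def using S_one by (auto simp: fraction_rel_iff)

lemma fraction_memD:
  assumes "(b, t) \<in> fraction R S a s"
  shows "a \<in> carrier R" "s \<in> S" "b \<in> carrier R" "t \<in> S" "\<exists>u\<in>S. u \<otimes> (t \<otimes> a) = u \<otimes> (s \<otimes> b)"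
  using assms unfolding fraction_def by (auto simp: fraction_rel_iff)

lemma fraction_mult:
  assumes "a \<in> carrier R" "s \<in> S" "b \<in> carrier R" "t \<in> S"
  shows "fraction R S a s \<otimes>\<^bsub>fraction_ring R S\<^esub> fraction R S b t = fraction R S (a \<otimes> b) (s \<otimes> t)"
proof -
  have "fraction R S (a' \<otimes> b') (s' \<otimes> t') = fraction R S (a \<otimes> b) (s \<otimes> t)"
    if 1: "(a', s') \<in> fraction R S a s" and 2: "(b', t') \<in> fraction R S b t" for a' s' b' t'
  proof -
    note m = fraction_memD[OF 1] fraction_memD[OF 2]
    obtain u v where uv: "u \<in> S" "v \<in> S"
      and u: "u \<otimes> (s' \<otimes> a) = u \<otimes> (s \<otimes> a')" and v: "v \<otimes> (t' \<otimes> b) = v \<otimes> (t \<otimes> b')"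
      using m by blast
    note c = m(1,3,6,8) m(2,4,7,9)[THEN S_carr] uv[THEN S_carr]
    have "(u \<otimes> v) \<otimes> ((s \<otimes> t) \<otimes> (a' \<otimes> b')) = (u \<otimes> (s \<otimes> a')) \<otimes> (v \<otimes> (t \<otimes> b'))"
      using c by (simp add: m_ac)
    also have "\<dots> = (u \<otimes> v) \<otimes> ((s' \<otimes> t') \<otimes> (a \<otimes> b))"
      unfolding u[symmetric] v[symmetric] using c by (simp add: m_ac)
    finally show ?thesis
      using c uv m S_mult by (subst fraction_eq_iff) (auto intro!: bexI[of _ "u \<otimes> v"])
  qed
  from UN_pairs_const[where F = "\<lambda>a s b t. fraction R S (a \<otimes> b) (s \<otimes> t)",
      OF fraction_mem[OF assms(1,2)] fraction_mem[OF assms(3,4)] this]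
  show ?thesis by (simp add: fraction_ring_def)
qed

lemma fraction_add:
  assumes "a \<in> carrier R" "s \<in> S" "b \<in> carrier R" "t \<in> S"
  shows "fraction R S a s \<oplus>\<^bsub>fraction_ring R S\<^esub> fraction R S b t = fraction R S (t \<otimes> a \<oplus> s \<otimes> b) (s \<otimes> t)"
proof -
  have "fraction R S (t' \<otimes> a' \<oplus> s' \<otimes> b') (s' \<otimes> t') = fraction R S (t \<otimes> a \<oplus> s \<otimes> b) (s \<otimes> t)"
    if 1: "(a', s') \<in> fraction R S a s" and 2: "(b', t') \<in> fraction R S b t" for a' s' b' t'
  proof -
    note m = fraction_memD[OF 1] fraction_memD[OF 2]
    obtain u v where uv: "u \<in> S" "v \<in> S"
      and u: "u \<otimes> (s' \<otimes> a) = u \<otimes> (s \<otimes> a')" and v: "v \<otimes> (t' \<otimes> b) = v \<otimes> (t \<otimes> b')"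
      using m by blast
    note c = m(1,3,6,8) m(2,4,7,9)[THEN S_carr] uv[THEN S_carr]
    have "(u \<otimes> v) \<otimes> ((s \<otimes> t) \<otimes> (t' \<otimes> a' \<oplus> s' \<otimes> b'))
        = (v \<otimes> t \<otimes> t') \<otimes> (u \<otimes> (s \<otimes> a')) \<oplus> (u \<otimes> s \<otimes> s') \<otimes> (v \<otimes> (t \<otimes> b'))"
      using c by (simp add: m_ac r_distr)
    also have "\<dots> = (u \<otimes> v) \<otimes> ((s' \<otimes> t') \<otimes> (t \<otimes> a \<oplus> s \<otimes> b))"
      unfolding u[symmetric] v[symmetric] using c by (simp add: m_ac r_distr)
    finally show ?thesis
      using c uv m S_mult by (subst fraction_eq_iff) (auto intro!: bexI[of _ "u \<otimes> v"])
  qed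
  from UN_pairs_const[where F = "\<lambda>a s b t. fraction R S (t \<otimes> a \<oplus> s \<otimes> b) (s \<otimes> t)",
      OF fraction_mem[OF assms(1,2)] fraction_mem[OF assms(3,4)] this]
  show ?thesis by (simp add: fraction_ring_def)
qed

lemma fraction_closed:
  "a \<in> carrier R \<Longrightarrow> s \<in> S \<Longrightarrow> fraction R S a s \<in> carrier (fraction_ring R S)"
  unfolding carrier_fraction_ring by blast

lemma fraction_cases:
  assumes "x \<in> carrier (fraction_ring R S)"
  obtains a s where "a \<in> carrier R" "s \<in> S" "x = fraction R S a s"
  using assms unfolding carrier_fraction_ring by blast

lemma fraction_eqI:
  assumes "a \<in> carrier R" "s \<in> S" "b \<in> carrier R" "t \<in> S" "t \<otimes> a = s \<otimes> b"
  shows "fraction R S a s = fraction R S b t"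
  using assms S_one by (subst fraction_eq_iff) auto

lemma fraction_zero: "\<zero>\<^bsub>fraction_ring R S\<^esub> = fraction R S \<zero> \<one>"
  and fraction_one: "\<one>\<^bsub>fraction_ring R S\<^esub> = fraction R S \<one> \<one>"
  by (simp_all add: fraction_ring_def)

lemma cring_fraction_ring: "cring (fraction_ring R S)"
proof (rule cringI)
  note simps = fraction_mult fraction_add fraction_zero fraction_one fraction_closed
    S_carr S_mult S_one
  show "abelian_group (fraction_ring R S)"
  proof (rule abelian_groupI)
    fix x y assume x: "x \<in> carrier (fraction_ring R S)" and y: "y \<in> carrier (fraction_ring R S)"
    obtain a s where a: "a \<in> carrier R" "s \<in> S" "x = fraction R S a s" using x by (rule fraction_cases)
    obtain b t where b: "b \<in> carrier R" "t \<in> S" "y = fraction R S b t" using y by (rule fraction_cases)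
    show "x \<oplus>\<^bsub>fraction_ring R S\<^esub> y \<in> carrier (fraction_ring R S)"
      using a b by (simp add: simps)
    show "x \<oplus>\<^bsub>fraction_ring R S\<^esub> y = y \<oplus>\<^bsub>fraction_ring R S\<^esub> x"
      using a b by (simp add: simps a_comm m_comm)
    fix z assume z: "z \<in> carrier (fraction_ring R S)"
    obtain c r where c: "c \<in> carrier R" "r \<in> S" "z = fraction R S c r" using z by (rule fraction_cases)
    show "x \<oplus>\<^bsub>fraction_ring R S\<^esub> y \<oplus>\<^bsub>fraction_ring R S\<^esub> z =
        x \<oplus>\<^bsub>fraction_ring R S\<^esub> (y \<oplus>\<^bsub>fraction_ring R S\<^esub> z)"
      using a b c by (simp add: simps) (rule fraction_eqI, simp_all add: simps r_distr m_ac a_ac)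
  next
    show "\<zero>\<^bsub>fraction_ring R S\<^esub> \<in> carrier (fraction_ring R S)" by (simp add: simps)
  next
    fix x assume x: "x \<in> carrier (fraction_ring R S)"
    obtain a s where a: "a \<in> carrier R" "s \<in> S" "x = fraction R S a s" using x by (rule fraction_cases)
    show "\<zero>\<^bsub>fraction_ring R S\<^esub> \<oplus>\<^bsub>fraction_ring R S\<^esub> x = x"
      using a by (simp add: simps)
    have "fraction R S (\<ominus> a) s \<oplus>\<^bsub>fraction_ring R S\<^esub> x = fraction R S (s \<otimes> \<ominus> a \<oplus> s \<otimes> a) (s \<otimes> s)"
      using a by (simp add: simps)
    also have "\<dots> = fraction R S \<zero> \<one>"
      using a by (intro fraction_eqI) (simp_all add: simps r_minus l_neg)
    finally show "\<exists>y\<in>carrier (fraction_ring R S).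
        y \<oplus>\<^bsub>fraction_ring R S\<^esub> x = \<zero>\<^bsub>fraction_ring R S\<^esub>"
      using a by (intro bexI[of _ "fraction R S (\<ominus> a) s"]) (simp_all add: simps)
  qed
  show "comm_monoid (fraction_ring R S)"
  proof (rule comm_monoidI)
    fix x y assume x: "x \<in> carrier (fraction_ring R S)" and y: "y \<in> carrier (fraction_ring R S)"
    obtain a s where a: "a \<in> carrier R" "s \<in> S" "x = fraction R S a s" using x by (rule fraction_cases)
    obtain b t where b: "b \<in> carrier R" "t \<in> S" "y = fraction R S b t" using y by (rule fraction_cases)
    show "x \<otimes>\<^bsub>fraction_ring R S\<^esub> y \<in> carrier (fraction_ring R S)"
      using a b by (simp add: simps)
    show "x \<otimes>\<^bsub>fraction_ring R S\<^esub> y = y \<otimes>\<^bsub>fraction_ring R S\<^esub> x"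
      using a b by (simp add: simps m_comm)
    fix z assume z: "z \<in> carrier (fraction_ring R S)"
    obtain c r where c: "c \<in> carrier R" "r \<in> S" "z = fraction R S c r" using z by (rule fraction_cases)
    show "x \<otimes>\<^bsub>fraction_ring R S\<^esub> y \<otimes>\<^bsub>fraction_ring R S\<^esub> z =
        x \<otimes>\<^bsub>fraction_ring R S\<^esub> (y \<otimes>\<^bsub>fraction_ring R S\<^esub> z)"
      using a b c by (simp add: simps m_assoc)
  next
    show "\<one>\<^bsub>fraction_ring R S\<^esub> \<in> carrier (fraction_ring R S)" by (simp add: simps)
  next
    fix x assume x: "x \<in> carrier (fraction_ring R S)"
    obtain a s where a: "a \<in> carrier R" "s \<in> S" "x = fraction R S a s" using x by (rule fraction_cases)
    show "\<one>\<^bsub>fraction_ring R S\<^esub> \<otimes>\<^bsub>fraction_ring R S\<^esub> x = x"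
      using a by (simp add: simps)
  qed
  fix x y z assume x: "x \<in> carrier (fraction_ring R S)" and y: "y \<in> carrier (fraction_ring R S)"
    and z: "z \<in> carrier (fraction_ring R S)"
  obtain a s where a: "a \<in> carrier R" "s \<in> S" "x = fraction R S a s" using x by (rule fraction_cases)
  obtain b t where b: "b \<in> carrier R" "t \<in> S" "y = fraction R S b t" using y by (rule fraction_cases)
  obtain c r where c: "c \<in> carrier R" "r \<in> S" "z = fraction R S c r" using z by (rule fraction_cases)
  show "(x \<oplus>\<^bsub>fraction_ring R S\<^esub> y) \<otimes>\<^bsub>fraction_ring R S\<^esub> z =
      x \<otimes>\<^bsub>fraction_ring R S\<^esub> z \<oplus>\<^bsub>fraction_ring R S\<^esub> y \<otimes>\<^bsub>fraction_ring R S\<^esub> z"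
    using a b c by (simp add: simps) (rule fraction_eqI, simp_all add: simps r_distr l_distr m_ac)
qed

lemma fraction_ring_hom: "(\<lambda>a. fraction R S a \<one>) \<in> ring_hom R (fraction_ring R S)"
  by (rule ring_hom_memI) (simp_all add: fraction_closed fraction_mult fraction_add fraction_one S_one)

end

lemma submonoid_compl_maximalideal:
  assumes "maximalideal P R"
  shows "submonoid (carrier R - P) R"
proof -
  interpret P: primeideal P R using assms by (rule maximalideal_prime)
  show ?thesis
  proof
    show "\<one> \<in> carrier R - P" using P.I_notcarr P.one_imp_carrier by auto
    show "x \<otimes> y \<in> carrier R - P" if "x \<in> carrier R - P" "y \<in> carrier R - P" for x y
      using that P.I_prime[of x y] by auto
  qed auto
qed

lemma cring_local_ring_at: "maximalideal P R \<Longrightarrow> cring (local_ring_at R P)"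
  unfolding local_ring_at_def by (intro cring_fraction_ring submonoid_compl_maximalideal)

lemma local_map_hom: "maximalideal P R \<Longrightarrow> local_map R P \<in> ring_hom R (local_ring_at R P)"
  using fraction_ring_hom[OF submonoid_compl_maximalideal]
  unfolding local_ring_at_def local_map_def[abs_def] by blast

text \<open>Hence the sum in \<^const>\<open>indexed_value\<close> is finite.\<close>

lemma finite_support_indexed_pset:
  assumes "f \<in> indexed_pset I (carrier R)"
  shows "finite {m. f m \<noteq> \<zero>}"
  using assms
proof induction
  case (indexed_const k)
  have "{m. local.indexed_const k m \<noteq> \<zero>} \<subseteq> {{#}}" by (auto simp: indexed_const_def)
  then show ?case using finite_subset by blast
next
  case (indexed_padd P Q)
  have "{m. (P \<Oplus> Q) m \<noteq> \<zero>} \<subseteq> {m. P m \<noteq> \<zero>} \<union> {m. Q m \<noteq> \<zero>}" by (auto simp: indexed_padd_def)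
  with indexed_padd show ?case using finite_subset by blast
next
  case (indexed_pmult P i)
  have "{m. (P \<Otimes> i) m \<noteq> \<zero>} \<subseteq> add_mset i ` {m. P m \<noteq> \<zero>}"
  proof
    fix m assume "m \<in> {m. (P \<Otimes> i) m \<noteq> \<zero>}"
    then have "i \<in># m" "P (m - {#i#}) \<noteq> \<zero>" by (auto simp: indexed_pmult_def split: if_splits)
    then show "m \<in> add_mset i ` {m. P m \<noteq> \<zero>}" by (intro image_eqI[of _ _ "m - {#i#}"]) auto
  qed
  with indexed_pmult show ?case using finite_subset by blast
qed

end

end

theory Submission
  imports Defs "HOL-Analysis.Abstract_Topological_Spaces"
begin

text \<open>A value \<open>f(r)\<close> outside \<open>P\<close> stays outside all \<open>M\<close> in a neighbourhood of \<open>P\<close>, which can be taken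
  clopen because \<open>Max R\<close> is compact, Hausdorff and totally disconnected. Finitely many such clopen
  sets cover \<open>Max R\<close>. By the Chinese remainder theorem there is \<open>e \<in> R\<close> congruent to \<open>1\<close> modulo every
  maximal ideal in a given clopen set and to \<open>0\<close> modulo all the others, so the local choices of \<open>r\<close>
  can be glued one by one to a single \<open>r\<close> for which \<open>f(r)\<close> lies in no maximal ideal.\<close>

context cring
begin

section \<open>Ideals, maximal ideals and units\<close>

text \<open>Negatives come from multiplying by \<open>\<ominus> \<one>\<close>, and commutativity
  makes absorption on one side enough.\<close>

lemma ideal_closedI:
  assumes "I \<subseteq> carrier R" "\<zero> \<in> I"
    and "\<And>a b. a \<in> I \<Longrightarrow> b \<in> I \<Longrightarrow> a \<oplus> b \<in> I"
    and l: "\<And>a x. a \<in> I \<Longrightarrow> x \<in> carrier R \<Longrightarrow> x \<otimes> a \<in> I"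
  shows "ideal I R"
proof (rule idealI[OF ring_axioms])
  have "\<ominus> a \<in> I" if "a \<in> I" for a
    using l[OF that, of "\<ominus> \<one>"] that assms(1) by (auto simp: l_minus)
  then show "subgroup I (add_monoid R)"
    using assms by (intro add.subgroupI) (auto simp: a_inv_def)
  show "x \<otimes> a \<in> I" "a \<otimes> x \<in> I" if "a \<in> I" "x \<in> carrier R" for a x
    using l[OF that] that assms(1) m_comm[of a x] by auto
qed

text \<open>Zorn's lemma applies to the ideals above \<open>I\<close> that omit
  \<open>\<one>\<close>: the union of a nonempty chain of them is again one. A maximal member is a
  maximal ideal, since a larger ideal either omits \<open>\<one>\<close> too or is the whole
  ring.\<close>

lemma exists_maximalideal_superset:
  assumes "ideal I R" "\<one> \<notin> I"
  obtains M where "M \<in> Max_ideals R" "I \<subseteq> M"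
proof -
  define A where "A = {J. ideal J R \<and> I \<subseteq> J \<and> \<one> \<notin> J}"
  have "\<Union>C \<in> A" if C: "C \<noteq> {}" "subset.chain A C" for C
  proof -
    have "subset.chain {J. ideal J R} C"
      using C(2) by (auto simp: subset.chain_def A_def)
    from chain_Union_is_ideal[OF this] have "ideal (\<Union>C) R" using C(1) by simp
    then show ?thesis using C by (auto simp: subset.chain_def A_def)
  qed
  moreover have "A \<noteq> {}" using assms by (auto simp: A_def)
  ultimately obtain M where M: "M \<in> A" "\<And>J. J \<in> A \<Longrightarrow> M \<subseteq> J \<Longrightarrow> J = M"
    using subset_Zorn_nonempty[of A] by blast
  have "maximalideal M R"
  proof (rule maximalidealI)
    show "ideal M R" "carrier R \<noteq> M" using M(1) by (auto simp: A_def)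
    show "J = M \<or> J = carrier R" if J: "ideal J R" "M \<subseteq> J" "J \<subseteq> carrier R" for J
    proof (cases "\<one> \<in> J")
      case True
      then show ?thesis using ideal.one_imp_carrier[OF J(1)] by simp
    next
      case False
      then have "J \<in> A" using J M(1) by (auto simp: A_def)
      then show ?thesis using M(2) J by blast
    qed
  qed
  then show ?thesis using that M(1) by (auto simp: A_def Max_ideals_def)
qed

lemma ideals_subset_sum:
  assumes "ideal I R" "ideal J R"
  shows "I \<union> J \<subseteq> I <+>\<^bsub>R\<^esub> J"
proof -
  have "I \<union> J \<subseteq> carrier R" using assms[THEN ideal.Icarr] by auto
  then show ?thesis unfolding union_genideal[OF assms, symmetric] by (rule genideal_self)
qed

lemma Max_idealsD:
  assumes "M \<in> Max_ideals R"
  shows "maximalideal M R" "ideal M R" "\<one> \<notin> M"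
proof -
  show *: "maximalideal M R" using assms by (simp add: Max_ideals_def)
  then show "ideal M R" by (simp add: maximalideal_def)
  then show "\<one> \<notin> M" using * ideal.one_imp_carrier maximalideal.I_notcarr by metis
qed

text \<open>A principal ideal that lies in no maximal ideal contains \<open>\<one>\<close>. This
  turns the search for a unit value into a condition on each point of the space.\<close>

lemma Units_iff_Max_ideals:
  assumes "a \<in> carrier R"
  shows "a \<in> Units R \<longleftrightarrow> (\<forall>M \<in> Max_ideals R. a \<notin> M)"
proof
  assume a: "a \<in> Units R"
  show "\<forall>M \<in> Max_ideals R. a \<notin> M"
  proof
    fix M assume M: "M \<in> Max_ideals R"
    show "a \<notin> M"
    proof
      assume "a \<in> M"
      then have "inv a \<otimes> a \<in> M"
        using a ideal.I_l_closed[OF Max_idealsD(2)[OF M]] by blast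
      then show False using a Max_idealsD(3)[OF M] by simp
    qed
  qed
next
  assume *: "\<forall>M \<in> Max_ideals R. a \<notin> M"
  have "\<one> \<in> PIdl a"
  proof (rule ccontr)
    assume "\<one> \<notin> PIdl a"
    then obtain M where "M \<in> Max_ideals R" "PIdl a \<subseteq> M"
      using exists_maximalideal_superset[OF cgenideal_ideal[OF assms]] by blast
    then show False using * cgenideal_self[OF assms] by blast
  qed
  then obtain x where "x \<in> carrier R" "\<one> = x \<otimes> a"
    unfolding cgenideal_def by blast
  then show "a \<in> Units R"
    using assms m_comm[of x a] by (auto simp: Units_def)
qed

section \<open>Compactness and clopen sets of the maximal spectrum\<close>

lemma openin_Max_space_nonvanishing:
  assumes "a \<in> carrier R"
  shows "openin (Max_space R) {M \<in> Max_ideals R. a \<notin> M}"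
  unfolding openin_Max_space using assms by (intro exI[of _ "{a}"]) auto

text \<open>The elements whose nonvanishing set is covered by finitely many members of the cover
  form an ideal \<open>I\<close>. If \<open>I\<close> were proper, it would lie in some
  \<open>M\<close>; a member of the cover around \<open>M\<close> contains the nonvanishing set of
  some \<open>a \<notin> M\<close>, which puts \<open>a\<close> into \<open>I\<close>. Hence
  \<open>\<one> \<in> I\<close>, and \<open>\<one>\<close> vanishes nowhere.\<close>

lemma compact_space_Max_space: "compact_space (Max_space R)"
  unfolding compact_space_alt topspace_Max_space
proof (intro allI impI, elim conjE)
  fix \<U> assume op: "\<forall>U\<in>\<U>. openin (Max_space R) U" and cov: "Max_ideals R \<subseteq> \<Union>\<U>"
  define I where "I = {a \<in> carrier R. \<exists>\<F>. finite \<F> \<and> \<F> \<subseteq> \<U> \<and> {M \<in> Max_ideals R. a \<notin> M} \<subseteq> \<Union>\<F>}"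
  have "ideal I R"
  proof (rule ideal_closedI)
    have "\<zero> \<in> M" if "M \<in> Max_ideals R" for M
      using Max_idealsD(2)[OF that] by (simp add: additive_subgroup.zero_closed ideal.axioms(1))
    then show "\<zero> \<in> I" by (auto simp: I_def intro!: exI[of _ "{}"])
    show "a \<oplus> b \<in> I" if ab: "a \<in> I" "b \<in> I" for a b
    proof -
      obtain \<F> \<G> where *: "finite \<F>" "\<F> \<subseteq> \<U>" "{M \<in> Max_ideals R. a \<notin> M} \<subseteq> \<Union>\<F>"
        "finite \<G>" "\<G> \<subseteq> \<U>" "{M \<in> Max_ideals R. b \<notin> M} \<subseteq> \<Union>\<G>"
        using ab unfolding I_def by blast
      have "a \<notin> M \<or> b \<notin> M" if "M \<in> Max_ideals R" "a \<oplus> b \<notin> M" for M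
        using that Max_idealsD(2)[OF that(1)]
        by (meson additive_subgroup.a_closed ideal.axioms(1))
      then have "{M \<in> Max_ideals R. a \<oplus> b \<notin> M} \<subseteq> \<Union>(\<F> \<union> \<G>)" using * by blast
      moreover have "finite (\<F> \<union> \<G>)" "\<F> \<union> \<G> \<subseteq> \<U>" using * by auto
      moreover have "a \<oplus> b \<in> carrier R" using ab by (auto simp: I_def)
      ultimately show ?thesis unfolding I_def by blast
    qed
    show "x \<otimes> a \<in> I" if a: "a \<in> I" and x: "x \<in> carrier R" for a x
    proof -
      have "{M \<in> Max_ideals R. x \<otimes> a \<notin> M} \<subseteq> {M \<in> Max_ideals R. a \<notin> M}"
        using ideal.I_l_closed[OF Max_idealsD(2)] x by blast
      then show ?thesis using a x unfolding I_def by fast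
    qed
  qed (auto simp: I_def)
  have "\<one> \<in> I"
  proof (rule ccontr)
    assume "\<one> \<notin> I"
    then obtain M where M: "M \<in> Max_ideals R" "I \<subseteq> M"
      using exists_maximalideal_superset[OF \<open>ideal I R\<close>] by blast
    then obtain U where U: "U \<in> \<U>" "M \<in> U" using cov by blast
    have "openin (Max_space R) U" using op U(1) by blast
    then obtain E where E: "E \<subseteq> carrier R" "U = Max_ideals R - {M \<in> Max_ideals R. E \<subseteq> M}"
      unfolding openin_Max_space by auto
    obtain a where a: "a \<in> E" "a \<notin> M" using U(2) E(2) M(1) by blast
    have "{M \<in> Max_ideals R. a \<notin> M} \<subseteq> \<Union>{U}" using a(1) by (auto simp: E(2))
    then have "a \<in> I" using a(1) E(1) U(1) unfolding I_def
      by (intro CollectI conjI exI[of _ "{U}"]) auto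
    then show False using M(2) a(2) by blast
  qed
  moreover have "{M \<in> Max_ideals R. \<one> \<notin> M} = Max_ideals R" using Max_idealsD(3) by blast
  ultimately show "\<exists>\<F>. finite \<F> \<and> \<F> \<subseteq> \<U> \<and> Max_ideals R \<subseteq> \<Union>\<F>"
    unfolding I_def by auto
qed

text \<open>The element \<open>e\<close> plays the role of the idempotent of \<open>V\<close> in the quotient of \<open>R\<close> by its
  Jacobson radical.\<close>

lemma clopen_Max_space_indicator:
  assumes "openin (Max_space R) V" "closedin (Max_space R) V"
  obtains e where "e \<in> carrier R" "\<And>M. M \<in> V \<Longrightarrow> \<one> \<ominus> e \<in> M"
    "\<And>M. M \<in> Max_ideals R - V \<Longrightarrow> e \<in> M"
proof -
  have "openin (Max_space R) (Max_ideals R - V)"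
    using assms(2) by (simp add: closedin_def topspace_Max_space)
  then obtain F where F: "F \<subseteq> carrier R" "Max_ideals R - V = Max_ideals R - {M \<in> Max_ideals R. F \<subseteq> M}"
    unfolding openin_Max_space by auto
  obtain E where E: "E \<subseteq> carrier R" "V = Max_ideals R - {M \<in> Max_ideals R. E \<subseteq> M}"
    using assms(1) unfolding openin_Max_space by auto
  have VM: "M \<in> Max_ideals R" if "M \<in> V" for M using that E(2) by simp
  have VE: "M \<in> V \<longleftrightarrow> \<not> E \<subseteq> M" if "M \<in> Max_ideals R" for M
    using that by (simp add: E(2))
  have VF: "M \<in> V \<longleftrightarrow> F \<subseteq> M" if "M \<in> Max_ideals R" for M
  proof -
    have "M \<in> Max_ideals R - V \<longleftrightarrow> M \<in> Max_ideals R - {M \<in> Max_ideals R. F \<subseteq> M}"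
      by (simp only: F(2))
    then show ?thesis using that by simp
  qed
  have id: "ideal (Idl E) R" "ideal (Idl F) R"
    using E F genideal_ideal by auto
  have sum: "ideal (Idl E <+>\<^bsub>R\<^esub> Idl F) R" by (rule add_ideals[OF id])
  have sub: "Idl E \<union> Idl F \<subseteq> Idl E <+>\<^bsub>R\<^esub> Idl F"
    by (rule ideals_subset_sum[OF id])
  \<comment> \<open>The maximal ideals containing \<open>E\<close> are those outside
    \<open>V\<close>, and those containing \<open>F\<close> are those in \<open>V\<close>. None
    contains both, so the two generated ideals are comaximal; the component of \<open>\<one>\<close>
    in \<open>Idl E\<close> is the indicator.\<close>
  have "\<one> \<in> Idl E <+>\<^bsub>R\<^esub> Idl F"
  proof (rule ccontr)
    assume "\<not> ?thesis"
    then obtain M where M: "M \<in> Max_ideals R" "Idl E <+>\<^bsub>R\<^esub> Idl F \<subseteq> M"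
      using exists_maximalideal_superset[OF sum] by blast
    then have "E \<subseteq> M" "F \<subseteq> M" using sub genideal_self[OF E(1)] genideal_self[OF F(1)] by blast+
    then show False using VE[OF M(1)] VF[OF M(1)] by simp
  qed
  then obtain e d where ed: "e \<in> Idl E" "d \<in> Idl F" "\<one> = e \<oplus> d"
    unfolding set_add_def' by blast
  have c: "e \<in> carrier R" "d \<in> carrier R"
    using ideal.Icarr[OF id(1) ed(1)] ideal.Icarr[OF id(2) ed(2)] .
  have "\<one> \<ominus> e = d" unfolding ed(3) using c by algebra
  show ?thesis
  proof (rule that[OF c(1)])
    show "\<one> \<ominus> e \<in> M" if "M \<in> V" for M
    proof -
      have "Idl F \<subseteq> M"
        using VF[OF VM[OF that]] that by (intro genideal_minimal Max_idealsD(2)[OF VM[OF that]]) simp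
      then show ?thesis using ed \<open>\<one> \<ominus> e = d\<close> by blast
    qed
    show "e \<in> M" if "M \<in> Max_ideals R - V" for M
    proof -
      have "Idl E \<subseteq> M"
        using VE[of M] that by (intro genideal_minimal Max_idealsD(2)) simp_all
      then show ?thesis using ed by blast
    qed
  qed
qed

section \<open>Polynomial values under homomorphisms and modulo ideals\<close>

lemma indexed_pset_coeff_closed:
  assumes "f \<in> indexed_pset I (carrier R)"
  shows "f m \<in> carrier R"
  using assms
  by (induction arbitrary: m)
    (auto simp: indexed_const_def indexed_padd_def indexed_pmult_def)

text \<open>Points of evaluation are controlled on \<open>I\<close> only; this guarantees that no
  other index enters a value.\<close>

lemma indexed_pset_support:
  assumes "f \<in> indexed_pset I (carrier R)" "f m \<noteq> \<zero>"
  shows "set_mset m \<subseteq> I"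
  using assms
proof (induction arbitrary: m)
  case (indexed_const k)
  then show ?case by (auto simp: indexed_const_def split: if_splits)
next
  case (indexed_padd P Q)
  then have "P m \<noteq> \<zero> \<or> Q m \<noteq> \<zero>" by (auto simp: indexed_padd_def)
  then show ?case using indexed_padd by blast
next
  case (indexed_pmult P i)
  then have "i \<in># m" "P (m - {#i#}) \<noteq> \<zero>" by (auto simp: indexed_pmult_def split: if_splits)
  then show ?case using indexed_pmult by (metis insert_DiffM insert_subset set_mset_add_mset_insert)
qed

lemma indexed_value_closed:
  assumes f: "f \<in> indexed_pset I (carrier R)" and "cring A" and h: "h \<in> ring_hom R A"
    and b: "b \<in> I \<rightarrow> carrier A"
  shows "indexed_value R A h f b \<in> carrier A"
proof -
  interpret A: cring A by fact
  show ?thesis unfolding indexed_value_def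
    using indexed_pset_support[OF f] indexed_pset_coeff_closed[OF f] ring_hom_closed[OF h] b
    by (intro A.finsum_closed Pi_I A.m_closed A.finprod_closed A.nat_pow_closed) blast+
qed

text \<open>Used both for the map into the local ring and for reduction modulo an ideal. The sum is
  indexed by the support of \<open>f\<close> in \<open>R\<close>, so the index set stays the same
  even when \<open>g\<close> kills coefficients.\<close>

lemma indexed_value_hom:
  assumes f: "f \<in> indexed_pset I (carrier R)" and "cring A" "cring B"
    and h: "h \<in> ring_hom R A" and b: "b \<in> I \<rightarrow> carrier A" and g: "g \<in> ring_hom A B"
  shows "g (indexed_value R A h f b) = indexed_value R B (g \<circ> h) f (g \<circ> b)"
proof -
  interpret g: ring_hom_cring A B g
    using assms by (simp add: ring_hom_cring.intro ring_hom_cring_axioms.intro)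
  have h': "h (f m) \<in> carrier A" for m
    using indexed_pset_coeff_closed[OF f] ring_hom_closed[OF h] by blast
  have b': "(\<lambda>i. b i [^]\<^bsub>A\<^esub> count m i) \<in> set_mset m \<rightarrow> carrier A" if "f m \<noteq> \<zero>" for m
    using indexed_pset_support[OF f that] b by blast
  have "g (indexed_value R A h f b) = finsum B
      (g \<circ> (\<lambda>m. h (f m) \<otimes>\<^bsub>A\<^esub> finprod A (\<lambda>i. b i [^]\<^bsub>A\<^esub> count m i) (set_mset m))) {m. f m \<noteq> \<zero>}"
    unfolding indexed_value_def using h' b'
    by (subst g.hom_finsum) (auto simp: comp_def intro!: g.R.m_closed g.R.finprod_closed)
  also have "\<dots> = indexed_value R B (g \<circ> h) f (g \<circ> b)"
    unfolding indexed_value_def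
  proof (rule g.S.finsum_cong', goal_cases)
    case 2
    have "g (b i) \<in> carrier B" if "f m \<noteq> \<zero>" "i \<in># m" for m i
      using indexed_pset_support[OF f that(1)] that(2) b by blast
    then show ?case using h' by (auto intro!: g.S.m_closed g.S.finprod_closed)
  next
    case (3 m)
    then have m: "f m \<noteq> \<zero>" by simp
    have bc: "b i \<in> carrier A" if "i \<in># m" for i
      using indexed_pset_support[OF f m] that b by blast
    have "g (finprod A (\<lambda>i. b i [^]\<^bsub>A\<^esub> count m i) (set_mset m)) =
        finprod B (\<lambda>i. (g \<circ> b) i [^]\<^bsub>B\<^esub> count m i) (set_mset m)"
      unfolding g.hom_finprod[OF b'[OF m]]
      using bc by (intro g.S.finprod_cong') auto
    then show ?case using h' g.R.finprod_closed[OF b'[OF m]] by simp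
  qed simp
  finally show ?thesis .
qed

lemma indexed_value_cong:
  assumes f: "f \<in> indexed_pset I (carrier R)"
    and b: "\<And>i. i \<in> I \<Longrightarrow> b i = c i" "c \<in> I \<rightarrow> carrier A" and "cring A" and h: "h \<in> ring_hom R A"
  shows "indexed_value R A h f b = indexed_value R A h f c"
proof -
  interpret A: cring A by fact
  have h': "h (f m) \<in> carrier A" for m
    using indexed_pset_coeff_closed[OF f] ring_hom_closed[OF h] by blast
  have c: "c i \<in> carrier A" "b i = c i" if "f m \<noteq> \<zero>" "i \<in># m" for m i
    using indexed_pset_support[OF f that(1)] that(2) b by blast+
  show ?thesis
    unfolding indexed_value_def
    using h' c
    by (intro A.finsum_cong' refl arg_cong2[where f = "monoid.mult A"] A.finprod_cong' Pi_I
        A.m_closed A.finprod_closed A.nat_pow_closed) auto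
qed

text \<open>The two points have the same image in the quotient by \<open>Q\<close>, so the values do
  as well. This transfers nonvanishing between congruent points, both in \<open>R\<close> modulo a
  maximal ideal and in the local ring.\<close>

lemma indexed_value_cong_ideal:
  assumes f: "f \<in> indexed_pset I (carrier R)" and A: "cring A" and h: "h \<in> ring_hom R A"
    and Q: "ideal Q A" and b: "b \<in> I \<rightarrow> carrier A" and c: "c \<in> I \<rightarrow> carrier A"
    and bc: "\<And>i. i \<in> I \<Longrightarrow> b i \<ominus>\<^bsub>A\<^esub> c i \<in> Q"
  shows "indexed_value R A h f b \<in> Q \<longleftrightarrow> indexed_value R A h f c \<in> Q"
proof -
  interpret A: cring A by fact
  interpret Q: ideal Q A by fact
  have B: "cring (A Quot Q)" by (rule Q.quotient_is_cring[OF A])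
  let ?g = "a_r_coset A Q"
  note g = Q.rcos_ring_hom
  have gh: "?g \<circ> h \<in> ring_hom R (A Quot Q)" by (rule ring_hom_trans[OF h g])
  have eq: "?g (b i) = ?g (c i)" if "i \<in> I" for i
    using A.quotient_eq_iff_same_a_r_cos[OF Q, of "b i" "c i"] b c bc that by blast
  have "indexed_value R (A Quot Q) (?g \<circ> h) f (?g \<circ> b) = indexed_value R (A Quot Q) (?g \<circ> h) f (?g \<circ> c)"
  proof (rule indexed_value_cong[OF f])
    show "?g \<circ> c \<in> I \<rightarrow> carrier (A Quot Q)" using ring_hom_closed[OF g] c by (auto simp: Pi_iff)
  qed (use eq B gh in auto)
  then have "?g (indexed_value R A h f b) = ?g (indexed_value R A h f c)"
    unfolding indexed_value_hom[OF f A B h b g] indexed_value_hom[OF f A B h c g] .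
  moreover note indexed_value_closed[OF f A h b] indexed_value_closed[OF f A h c]
  \<comment> \<open>If one value lies in \<open>Q\<close>, its coset is \<open>Q\<close>; the other
    value lies in its own coset, which is the same one.\<close>
  ultimately show ?thesis
    by (metis Q.a_rcos_const Q.a_rcos_self)
qed

section \<open>From values in the local ring to values in the ring\<close>

text \<open>\<open>Q\<close> is the extension of \<open>P\<close> to the local ring. Membership can
  be tested on any representative: if \<open>a/s = b/t\<close> with \<open>b \<in> P\<close>, then
  \<open>u \<otimes> (t \<otimes> a) \<in> P\<close> for some \<open>u\<close> outside
  \<open>P\<close>, and primeness removes \<open>u\<close> and \<open>t\<close>.\<close>

lemma local_ring_at_ideal:
  assumes "maximalideal P R"
  defines "Q \<equiv> {fraction R (carrier R - P) a s |a s. a \<in> P \<and> s \<in> carrier R - P}"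
  shows "ideal Q (local_ring_at R P)" "\<And>s. s \<in> carrier R - P \<Longrightarrow> a \<in> carrier R \<Longrightarrow>
    fraction R (carrier R - P) a s \<in> Q \<longleftrightarrow> a \<in> P"
proof -
  define S where "S = carrier R - P"
  have S: "submonoid S R" unfolding S_def by (rule submonoid_compl_maximalideal[OF assms(1)])
  interpret P: primeideal P R using assms(1) by (rule maximalideal_prime)
  interpret L: cring "local_ring_at R P" by (rule cring_local_ring_at[OF assms(1)])
  have L: "local_ring_at R P = fraction_ring R S" by (simp add: local_ring_at_def S_def)
  have Q: "Q = {fraction R S a s |a s. a \<in> P \<and> s \<in> S}" by (simp add: Q_def S_def)
  note simps = fraction_mult[OF S] fraction_add[OF S] fraction_closed[OF S] S_carr[OF S] S_mult[OF S]
  show "ideal Q (local_ring_at R P)"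
  proof (rule L.ideal_closedI)
    show "Q \<subseteq> carrier (local_ring_at R P)"
      unfolding L Q using fraction_closed[OF S] P.Icarr by auto
    show "\<zero>\<^bsub>local_ring_at R P\<^esub> \<in> Q"
      unfolding L Q fraction_zero[OF S] using S_one[OF S] P.zero_closed by blast
    show "x \<oplus>\<^bsub>local_ring_at R P\<^esub> y \<in> Q" if xy: "x \<in> Q" "y \<in> Q" for x y
    proof -
      obtain a s b t where *: "a \<in> P" "s \<in> S" "x = fraction R S a s" "b \<in> P" "t \<in> S" "y = fraction R S b t"
        using xy unfolding Q by auto
      have "t \<otimes> a \<oplus> s \<otimes> b \<in> P" using * by (simp add: P.a_closed P.I_l_closed simps)
      moreover have "x \<oplus>\<^bsub>local_ring_at R P\<^esub> y = fraction R S (t \<otimes> a \<oplus> s \<otimes> b) (s \<otimes> t)"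
        using * by (simp add: L simps P.Icarr)
      ultimately show ?thesis using S_mult[OF S *(2,5)] unfolding Q by blast
    qed
    show "y \<otimes>\<^bsub>local_ring_at R P\<^esub> x \<in> Q" if x: "x \<in> Q" and y: "y \<in> carrier (local_ring_at R P)" for x y
    proof -
      obtain a s where *: "a \<in> P" "s \<in> S" "x = fraction R S a s"
        using x unfolding Q by auto
      obtain b t where **: "b \<in> carrier R" "t \<in> S" "y = fraction R S b t"
        using y unfolding L by (rule fraction_cases[OF S])
      have "b \<otimes> a \<in> P" using * ** by (simp add: P.I_l_closed)
      moreover have "y \<otimes>\<^bsub>local_ring_at R P\<^esub> x = fraction R S (b \<otimes> a) (t \<otimes> s)"
        using * ** by (simp add: L simps P.Icarr)
      ultimately show ?thesis using S_mult[OF S **(2) *(2)] unfolding Q by blast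
    qed
  qed
  fix s assume s: "s \<in> carrier R - P" and a: "a \<in> carrier R"
  show "fraction R (carrier R - P) a s \<in> Q \<longleftrightarrow> a \<in> P"
  proof
    assume "fraction R (carrier R - P) a s \<in> Q"
    then obtain b t where *: "b \<in> P" "t \<in> S" "fraction R S a s = fraction R S b t"
      unfolding Q S_def[symmetric] by auto
    then obtain u where u: "u \<in> S" "u \<otimes> (t \<otimes> a) = u \<otimes> (s \<otimes> b)"
      using fraction_eq_iff[OF S, of a s b t] a s P.Icarr by (auto simp: S_def)
    have "u \<otimes> (t \<otimes> a) \<in> P" unfolding u(2) using * u(1) s by (simp add: P.I_l_closed simps)
    then show "a \<in> P" using u(1) *(2) a P.I_prime[of u "t \<otimes> a"] P.I_prime[of t a] by (auto simp: S_def)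
  qed (use s in \<open>auto simp: Q_def\<close>)
qed

text \<open>By maximality \<open>P\<close> and \<open>s\<close> together generate the whole ring;
  \<open>t\<close> is the coefficient of \<open>s\<close> in an expression for
  \<open>\<one>\<close>, an inverse of \<open>s\<close> modulo \<open>P\<close>.\<close>

lemma maximalideal_inverse:
  assumes "maximalideal P R" "s \<in> carrier R - P"
  obtains t where "t \<in> carrier R" "\<one> \<ominus> s \<otimes> t \<in> P"
proof -
  interpret P: maximalideal P R by fact
  have s: "s \<in> carrier R" "s \<notin> P" using assms(2) by auto
  have id: "ideal P R" "ideal (PIdl s) R" using P.is_ideal cgenideal_ideal[OF s(1)] by auto
  have sub: "P \<union> PIdl s \<subseteq> P <+>\<^bsub>R\<^esub> PIdl s"
    by (rule ideals_subset_sum[OF id])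
  then have "P <+>\<^bsub>R\<^esub> PIdl s \<noteq> P" using cgenideal_self[OF s(1)] s(2) by blast
  then have "P <+>\<^bsub>R\<^esub> PIdl s = carrier R"
    using P.I_maximal[OF add_ideals[OF id]] sub ideal.Icarr[OF add_ideals[OF id]] by blast
  then have "\<one> \<in> P <+>\<^bsub>R\<^esub> PIdl s" by simp
  then obtain p t where *: "p \<in> P" "t \<in> carrier R" "\<one> = p \<oplus> t \<otimes> s"
    unfolding set_add_def' cgenideal_def by blast
  have "\<one> \<ominus> s \<otimes> t = p" unfolding *(3) using *(2) s(1) P.Icarr[OF *(1)] by algebra
  then show ?thesis using that * by blast
qed

text \<open>The residue field of \<open>R\<^sub>P\<close> is \<open>R / P\<close>, so a local value may be replaced by a global one.\<close>

lemma unit_value_local_imp_global: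
  assumes P: "maximalideal P R" and f: "f \<in> indexed_pset I (carrier R)"
    and b: "b \<in> I \<rightarrow> carrier (local_ring_at R P)"
    and unit: "indexed_value R (local_ring_at R P) (local_map R P) f b \<in> Units (local_ring_at R P)"
  obtains r where "r \<in> I \<rightarrow> carrier R" "indexed_value R R (\<lambda>a. a) f r \<notin> P"
proof -
  define S where "S = carrier R - P"
  have S: "submonoid S R" unfolding S_def by (rule submonoid_compl_maximalideal[OF P])
  define L where "L = local_ring_at R P"
  have L: "L = fraction_ring R S" by (simp add: L_def local_ring_at_def S_def)
  interpret L: cring L unfolding L_def by (rule cring_local_ring_at[OF P])
  interpret P: maximalideal P R by fact
  define Q where "Q = {fraction R S a s |a s. a \<in> P \<and> s \<in> S}"
  have Q_iff: "fraction R S a s \<in> Q \<longleftrightarrow> a \<in> P" if "s \<in> S" "a \<in> carrier R" for a s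
    using local_ring_at_ideal(2)[OF P] that unfolding Q_def S_def by blast
  have Q: "ideal Q L"
    using local_ring_at_ideal(1)[OF P] unfolding L_def Q_def S_def .
  note simps = fraction_mult[OF S] fraction_add[OF S] fraction_closed[OF S] S_carr[OF S] S_mult[OF S]
    S_one[OF S]
  have hom: "local_map R P \<in> ring_hom R L" unfolding L_def by (rule local_map_hom[OF P])
  have lm: "local_map R P a = fraction R S a \<one>" for a by (simp add: local_map_def S_def)
  have ex: "\<exists>r \<in> carrier R. x \<ominus>\<^bsub>L\<^esub> local_map R P r \<in> Q" if x: "x \<in> carrier L" for x
  proof -
    obtain a s where *: "a \<in> carrier R" "s \<in> S" "x = fraction R S a s"
      using x unfolding L by (rule fraction_cases[OF S])
    obtain t where t: "t \<in> carrier R" "\<one> \<ominus> s \<otimes> t \<in> P"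
      using maximalideal_inverse[OF P] *(2) unfolding S_def by blast
    \<comment> \<open>As \<open>t\<close> inverts \<open>s\<close> modulo \<open>P\<close>, the
      fraction \<open>a/s\<close> should agree with \<open>a \<otimes> t\<close>. The error is
      \<open>?q\<close>, whose numerator is in \<open>P\<close>; it is checked by adding back, so
      that \<open>fraction_add\<close> applies.\<close>
    let ?r = "a \<otimes> t"
    have s: "s \<in> carrier R" using * simps by simp
    let ?q = "fraction R S (a \<otimes> (\<one> \<ominus> s \<otimes> t)) s"
    have "?q \<oplus>\<^bsub>L\<^esub> local_map R P ?r = fraction R S (\<one> \<otimes> (a \<otimes> (\<one> \<ominus> s \<otimes> t)) \<oplus> s \<otimes> ?r) (s \<otimes> \<one>)"
      unfolding L lm using * t s by (simp add: simps)
    also have "\<one> \<otimes> (a \<otimes> (\<one> \<ominus> s \<otimes> t)) \<oplus> s \<otimes> ?r = a" using * t s by algebra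
    finally have "x = ?q \<oplus>\<^bsub>L\<^esub> local_map R P ?r" using * s by simp
    moreover have "?q \<in> carrier L" "local_map R P ?r \<in> carrier L"
      unfolding L lm using * t s by (auto simp: simps)
    ultimately have "x \<ominus>\<^bsub>L\<^esub> local_map R P ?r = ?q"
      by (simp add: L.minus_eq L.a_assoc L.r_neg)
    moreover have "?q \<in> Q" using *(1,2) t(2) P.I_l_closed unfolding Q_def by blast
    ultimately show ?thesis using * t by (intro bexI[of _ ?r]) auto
  qed
  have "\<exists>r. \<forall>i \<in> I. r i \<in> carrier R \<and> b i \<ominus>\<^bsub>L\<^esub> local_map R P (r i) \<in> Q"
    by (intro bchoice) (use ex b in \<open>auto simp: L_def\<close>)
  then obtain r where r: "\<And>i. i \<in> I \<Longrightarrow> r i \<in> carrier R"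
      "\<And>i. i \<in> I \<Longrightarrow> b i \<ominus>\<^bsub>L\<^esub> local_map R P (r i) \<in> Q" by blast
  have rI: "r \<in> I \<rightarrow> carrier R" using r by blast
  have idhom: "(\<lambda>a. a) \<in> ring_hom R R" by (rule ring_hom_memI) auto
  show ?thesis
  proof (rule that[OF rI], rule notI)
    let ?v = "indexed_value R R (\<lambda>a. a) f r"
    \<comment> \<open>Then the local value at the image of \<open>r\<close> lies in
      \<open>Q\<close>, and by congruence so does the value at \<open>b\<close>. A unit in
      \<open>Q\<close> would force \<open>\<one> \<in> P\<close>.\<close>
    assume "?v \<in> P"
    then have "local_map R P ?v \<in> Q" unfolding lm Q_def using S_one[OF S] by blast
    then have "indexed_value R L (local_map R P) f (local_map R P \<circ> r) \<in> Q"
      using indexed_value_hom[OF f is_cring L.is_cring idhom rI hom] by (simp add: comp_def)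
    then have "indexed_value R L (local_map R P) f b \<in> Q"
      using indexed_value_cong_ideal[OF f L.is_cring hom Q, of b "local_map R P \<circ> r"] b r
        ring_hom_closed[OF hom] by (auto simp: L_def)
    moreover have "indexed_value R L (local_map R P) f b \<in> Units L" using unit by (simp add: L_def)
    ultimately have "\<one>\<^bsub>L\<^esub> \<in> Q"
      using ideal.I_l_closed[OF Q] L.Units_l_inv L.Units_inv_closed by metis
    then have "\<one> \<in> P" unfolding L fraction_one[OF S] using Q_iff[OF S_one[OF S] one_closed] by blast
    then show False using P.one_imp_carrier P.I_notcarr by auto
  qed
qed

section \<open>Clopen neighbourhoods and gluing\<close>

text \<open>Connected sets have at most one point, so none meets both \<open>P\<close> and the
  complement of \<open>U\<close>. In a compact Hausdorff space the cut wire fence theorem then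
  separates the two by a clopen set.\<close>

lemma Max_space_clopen_nbhd:
  assumes "Hausdorff_space (Max_space R)" "totally_disconnected_space (Max_space R)"
    and U: "openin (Max_space R) U" and P: "P \<in> U"
  obtains V where "openin (Max_space R) V" "closedin (Max_space R) V" "P \<in> V" "V \<subseteq> U"
proof -
  have "separated_between (Max_space R) {P} (topspace (Max_space R) - U)"
  proof (rule cut_wire_fence_theorem_gen[OF compact_space_Max_space])
    show "compactin (Max_space R) {P}" using U P openin_subset by fastforce
    show "disjnt C {P} \<or> disjnt C (topspace (Max_space R) - U)" if C: "connectedin (Max_space R) C" for C
    proof -
      obtain x where "C \<subseteq> {x}" using assms(2) C by (auto simp: totally_disconnected_space_def)
      then show ?thesis using P by (auto simp: disjnt_def)
    qed
  qed (use assms in auto)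
  then obtain V where "closedin (Max_space R) V" "openin (Max_space R) V" "P \<in> V"
      "topspace (Max_space R) - U \<subseteq> topspace (Max_space R) - V"
    by (auto simp: separated_between)
  then show ?thesis using that openin_subset by blast
qed

text \<open>Only \<open>V\<close> has to be clopen, since it alone supplies the indicator;
  \<open>W\<close> may be any set of maximal ideals, so gluing can be iterated with \<open>W\<close>
  the union handled so far.\<close>

lemma glue_values:
  assumes f: "f \<in> indexed_pset I (carrier R)"
    and V: "openin (Max_space R) V" "closedin (Max_space R) V"
    and r: "r \<in> I \<rightarrow> carrier R" "\<And>M. M \<in> V \<Longrightarrow> indexed_value R R (\<lambda>a. a) f r \<notin> M"
    and r': "r' \<in> I \<rightarrow> carrier R" "\<And>M. M \<in> W \<Longrightarrow> indexed_value R R (\<lambda>a. a) f r' \<notin> M"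
    and W: "W \<subseteq> Max_ideals R"
  shows "\<exists>q \<in> I \<rightarrow> carrier R. \<forall>M \<in> V \<union> W. indexed_value R R (\<lambda>a. a) f q \<notin> M"
proof -
  obtain e where e: "e \<in> carrier R" "\<And>M. M \<in> V \<Longrightarrow> \<one> \<ominus> e \<in> M" "\<And>M. M \<in> Max_ideals R - V \<Longrightarrow> e \<in> M"
    using clopen_Max_space_indicator[OF V] by blast
  have idhom: "(\<lambda>a. a) \<in> ring_hom R R" by (rule ring_hom_memI) auto
  \<comment> \<open>Interpolation: \<open>e\<close> is \<open>\<one>\<close> modulo the members of
    \<open>V\<close>, where \<open>q\<close> becomes \<open>r\<close>, and \<open>\<zero>\<close>
    modulo all other maximal ideals, where \<open>q\<close> becomes \<open>r'\<close>. On the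
    overlap of \<open>V\<close> and \<open>W\<close> the tuple \<open>r\<close> decides.\<close>
  define q where "q i = r' i \<oplus> e \<otimes> (r i \<ominus> r' i)" for i
  have q: "q \<in> I \<rightarrow> carrier R" using r r' e(1) by (auto simp: q_def Pi_iff)
  have "indexed_value R R (\<lambda>a. a) f q \<notin> M" if M: "M \<in> V \<union> W" for M
  proof (cases "M \<in> V")
    case True
    then have "M \<in> Max_ideals R" using V(1) openin_subset topspace_Max_space by blast
    note id = Max_idealsD(2)[OF this]
    have "q i \<ominus> r i \<in> M" if "i \<in> I" for i
    proof -
      have "r i \<in> carrier R" "r' i \<in> carrier R" using r(1) r'(1) that by auto
      then have "q i \<ominus> r i = (r' i \<ominus> r i) \<otimes> (\<one> \<ominus> e)" unfolding q_def using e(1) by algebra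
      then show ?thesis using e(2)[OF True] ideal.I_l_closed[OF id] \<open>r i \<in> carrier R\<close> \<open>r' i \<in> carrier R\<close> by simp
    qed
    then show ?thesis using indexed_value_cong_ideal[OF f is_cring idhom id q r(1)] r(2)[OF True] by blast
  next
    case False
    then have "M \<in> W" "M \<in> Max_ideals R - V" using M W by blast+
    then have id: "ideal M R" using Max_idealsD(2) by blast
    have "q i \<ominus> r' i \<in> M" if "i \<in> I" for i
    proof -
      have "r i \<in> carrier R" "r' i \<in> carrier R" using r(1) r'(1) that by auto
      then have "q i \<ominus> r' i = (r i \<ominus> r' i) \<otimes> e" unfolding q_def using e(1) by algebra
      then show ?thesis using e(3)[OF \<open>M \<in> Max_ideals R - V\<close>] ideal.I_l_closed[OF id]
        \<open>r i \<in> carrier R\<close> \<open>r' i \<in> carrier R\<close> by simp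
    qed
    then show ?thesis using indexed_value_cong_ideal[OF f is_cring idhom id q r'(1)] r'(2)[OF \<open>M \<in> W\<close>] by blast
  qed
  then show ?thesis using q by blast
qed

text \<open>Here \<open>r\<close> in \<open>loc\<close> may depend on \<open>P\<close>; compactness
  leaves finitely many choices, and induction over the finite subcover merges them.\<close>

lemma exists_unit_value:
  assumes H: "Hausdorff_space (Max_space R)" "totally_disconnected_space (Max_space R)"
    and f: "f \<in> indexed_pset I (carrier R)"
    and loc: "\<And>P. P \<in> Max_ideals R \<Longrightarrow> \<exists>r \<in> I \<rightarrow> carrier R. indexed_value R R (\<lambda>a. a) f r \<notin> P"
  shows "\<exists>r \<in> I \<rightarrow> carrier R. indexed_value R R (\<lambda>a. a) f r \<in> Units R"
proof -
  let ?v = "indexed_value R R (\<lambda>a. a) f"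
  have idhom: "(\<lambda>a. a) \<in> ring_hom R R" by (rule ring_hom_memI) auto
  note v = indexed_value_closed[OF f is_cring idhom]
  \<comment> \<open>The clopen sets on which a single tuple serves all points.\<close>
  define \<V> where "\<V> = {V. openin (Max_space R) V \<and> closedin (Max_space R) V \<and>
    (\<exists>r \<in> I \<rightarrow> carrier R. \<forall>M \<in> V. ?v r \<notin> M)}"
  have "Max_ideals R \<subseteq> \<Union>\<V>"
  proof
    fix P assume P: "P \<in> Max_ideals R"
    then obtain r where r: "r \<in> I \<rightarrow> carrier R" "?v r \<notin> P" using loc by blast
    obtain V where "openin (Max_space R) V" "closedin (Max_space R) V" "P \<in> V"
        "V \<subseteq> {M \<in> Max_ideals R. ?v r \<notin> M}"
      using Max_space_clopen_nbhd[OF H openin_Max_space_nonvanishing[OF v[OF r(1)]]] P r(2) by blast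
    then have "V \<in> \<V>" using r(1) unfolding \<V>_def by blast
    then show "P \<in> \<Union>\<V>" using \<open>P \<in> V\<close> by blast
  qed
  moreover have "\<forall>V\<in>\<V>. openin (Max_space R) V" by (simp add: \<V>_def)
  ultimately obtain \<F> where F: "finite \<F>" "\<F> \<subseteq> \<V>" "Max_ideals R \<subseteq> \<Union>\<F>"
    using compact_space_Max_space unfolding compact_space_alt topspace_Max_space by meson
  have "\<exists>r \<in> I \<rightarrow> carrier R. \<forall>M \<in> \<Union>\<F>. ?v r \<notin> M"
    using F(1,2)
  proof induction
    case empty
    \<comment> \<open>Over the empty union there is no condition, so any tuple starts the
      induction.\<close>
    have "(\<lambda>_. \<zero>) \<in> I \<rightarrow> carrier R" by simp
    then show ?case by blast
  next
    case (insert V \<F>)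
    have sub: "V \<in> \<V>" "\<F> \<subseteq> \<V>" using insert.prems by auto
    obtain r where r: "r \<in> I \<rightarrow> carrier R" "\<And>M. M \<in> \<Union>\<F> \<Longrightarrow> ?v r \<notin> M"
      using insert.IH[OF sub(2)] by metis
    have V: "openin (Max_space R) V" "closedin (Max_space R) V" using sub(1) by (auto simp: \<V>_def)
    obtain r' where r': "r' \<in> I \<rightarrow> carrier R" "\<And>M. M \<in> V \<Longrightarrow> ?v r' \<notin> M"
      using sub(1) by (auto simp: \<V>_def)
    have "\<Union>\<F> \<subseteq> Max_ideals R"
      using sub(2) by (auto simp: \<V>_def dest!: openin_subset simp flip: topspace_Max_space)
    \<comment> \<open>The new set \<open>V\<close> supplies the indicator with its tuple
      \<open>r'\<close>; the union of the earlier sets, with \<open>r\<close>, takes the place of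
      \<open>W\<close>.\<close>
    from glue_values[OF f V r' r this] show ?case by simp
  qed
  then obtain r where r: "r \<in> I \<rightarrow> carrier R" "\<And>M. M \<in> \<Union>\<F> \<Longrightarrow> ?v r \<notin> M" by metis
  have "?v r \<notin> M" if "M \<in> Max_ideals R" for M
    using r(2) subsetD[OF F(3) that] by blast
  then have "?v r \<in> Units R" by (simp add: Units_iff_Max_ideals[OF v[OF r(1)]])
  then show ?thesis using r(1) by blast
qed

end

theorem corollary1p2:
  fixes R :: "('a, 'm) ring_scheme"
  assumes "cring R"
    and "Hausdorff_space (Max_space R)"
    and "totally_disconnected_space (Max_space R)"
  shows "local_global R"
proof -
  interpret cring R by fact
  show ?thesis
    unfolding local_global_def
  proof (intro allI ballI impI)
    fix n :: nat and f :: "nat multiset \<Rightarrow> 'a"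
    assume f: "f \<in> indexed_pset {1..n} (carrier R)"
      and loc: "\<forall>P. maximalideal P R \<longrightarrow> (\<exists>b \<in> {1..n} \<rightarrow> carrier (local_ring_at R P).
          indexed_value R (local_ring_at R P) (local_map R P) f b \<in> Units (local_ring_at R P))"
    show "\<exists>r \<in> {1..n} \<rightarrow> carrier R. indexed_value R R (\<lambda>a. a) f r \<in> Units R"
      using exists_unit_value[OF assms(2,3) f] unit_value_local_imp_global[OF _ f] loc Max_idealsD(1)
      by metis
  qed
qed

end
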